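(* Let $n\geq1$, let $\tau$ be a triangular norm without zero divisors, and let $\mathbb{X}_1=\langle X_1;\mu_{X_1}\rangle,\dots,\mathbb{X}_n=\langle X_n;\mu_{X_n}\rangle$ be bounded fuzzy lattices. Then $\langle\prod_{i=1}^n X_i;\mu_p\rangle$ is a bounded fuzzy lattice, where $\mu_p((x_1,\dots,x_n),(y_1,\dots,y_n))=\tau^{(n)}(\mu_{X_1}(x_1,y_1),\dots,\mu_{X_n}(x_n,y_n))$.
   Context: A fuzzy relation on a set $X$ is a map $\mu\colon X\times X\to[0,1]$; it is reflexive if $\mu(x,x)=1$; transitive if $\mu(x,y)>0$ and $\mu(y,z)>0$ imply $\mu(x,z)>0$; anti-symmetric if $\mu(x,y)>0$ and $\mu(y,x)>0$ imply $x=y$. A fuzzy poset is $\langle X;\mu\rangle$ with $\mu$ reflexive, transitive, anti-symmetric. For $Y\subseteq X$: $x$ is a fuzzy lower (upper) bound of $Y$ if $\mu(x,y)>0$ (resp. $\mu(y,x)>0$) for all $y\in Y$; a fuzzy lower bound $x_0$ of $Y$ is its fuzzy meet if $\mu(x,x_0)>0$ for every fuzzy lower bound $x$; a fuzzy upper bound $x_0$ is its fuzzy join if $\mu(x_0,x)>0$ for every fuzzy upper bound $x$. A fuzzy lattice is a fuzzy poset in which every two-element subset $\{x,y\}$ has a fuzzy meet and a fuzzy join; it is bounded if there exist $0_X,1_X$ with $\mu(0_X,x)>0$ and $\mu(x,1_X)>0$ for all $x$. A triangular norm is a map $\tau\colon[0,1]^2\to[0,1]$ that is associative, commutative, monotone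 in each argument and satisfies $\tau(a,1)=a$; it has zero divisors if $\tau(a,b)=0$ for some $a,b\in(0,1)$, otherwise it is without zero divisors. Its $n$-ary extension: $\tau^{(1)}(a_1)=a_1$, $\tau^{(n)}(a_1,\dots,a_n)=\tau(\tau^{(n-1)}(a_1,\dots,a_{n-1}),a_n)$. *)

theory Defs
  imports Complex_Main "HOL-Library.FuncSet"
begin

definition fuzzy_relation :: "'a set \<Rightarrow> ('a \<Rightarrow> 'a \<Rightarrow> real) \<Rightarrow> bool" where
  "fuzzy_relation X \<mu> \<longleftrightarrow> (\<forall>x\<in>X. \<forall>y\<in>X. \<mu> x y \<in> {0..1})"

definition fuzzy_reflexive :: "'a set \<Rightarrow> ('a \<Rightarrow> 'a \<Rightarrow> real) \<Rightarrow> bool" where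
  "fuzzy_reflexive X \<mu> \<longleftrightarrow> (\<forall>x\<in>X. \<mu> x x = 1)"

definition fuzzy_transitive :: "'a set \<Rightarrow> ('a \<Rightarrow> 'a \<Rightarrow> real) \<Rightarrow> bool" where
  "fuzzy_transitive X \<mu> \<longleftrightarrow>
     (\<forall>x\<in>X. \<forall>y\<in>X. \<forall>z\<in>X. \<mu> x y > 0 \<and> \<mu> y z > 0 \<longrightarrow> \<mu> x z > 0)"

definition fuzzy_antisymmetric :: "'a set \<Rightarrow> ('a \<Rightarrow> 'a \<Rightarrow> real) \<Rightarrow> bool" where
  "fuzzy_antisymmetric X \<mu> \<longleftrightarrow>
     (\<forall>x\<in>X. \<forall>y\<in>X. \<mu> x y > 0 \<and> \<mu> y x > 0 \<longrightarrow> x = y)"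

definition fuzzy_poset :: "'a set \<Rightarrow> ('a \<Rightarrow> 'a \<Rightarrow> real) \<Rightarrow> bool" where
  "fuzzy_poset X \<mu> \<longleftrightarrow> fuzzy_relation X \<mu> \<and> fuzzy_reflexive X \<mu> \<and>
     fuzzy_transitive X \<mu> \<and> fuzzy_antisymmetric X \<mu>"

definition fuzzy_lower_bound ::
    "'a set \<Rightarrow> ('a \<Rightarrow> 'a \<Rightarrow> real) \<Rightarrow> 'a set \<Rightarrow> 'a \<Rightarrow> bool" where
  "fuzzy_lower_bound X \<mu> Y x \<longleftrightarrow> x \<in> X \<and> (\<forall>y\<in>Y. \<mu> x y > 0)"

definition fuzzy_upper_bound ::
    "'a set \<Rightarrow> ('a \<Rightarrow> 'a \<Rightarrow> real) \<Rightarrow> 'a set \<Rightarrow> 'a \<Rightarrow> bool" where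
  "fuzzy_upper_bound X \<mu> Y x \<longleftrightarrow> x \<in> X \<and> (\<forall>y\<in>Y. \<mu> y x > 0)"

definition is_fuzzy_meet ::
    "'a set \<Rightarrow> ('a \<Rightarrow> 'a \<Rightarrow> real) \<Rightarrow> 'a set \<Rightarrow> 'a \<Rightarrow> bool" where
  "is_fuzzy_meet X \<mu> Y x\<^sub>0 \<longleftrightarrow> fuzzy_lower_bound X \<mu> Y x\<^sub>0 \<and>
     (\<forall>x. fuzzy_lower_bound X \<mu> Y x \<longrightarrow> \<mu> x x\<^sub>0 > 0)"

definition is_fuzzy_join ::
    "'a set \<Rightarrow> ('a \<Rightarrow> 'a \<Rightarrow> real) \<Rightarrow> 'a set \<Rightarrow> 'a \<Rightarrow> bool" where
  "is_fuzzy_join X \<mu> Y x\<^sub>0 \<longleftrightarrow> fuzzy_upper_bound X \<mu> Y x\<^sub>0 \<and>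
     (\<forall>x. fuzzy_upper_bound X \<mu> Y x \<longrightarrow> \<mu> x\<^sub>0 x > 0)"

definition fuzzy_lattice :: "'a set \<Rightarrow> ('a \<Rightarrow> 'a \<Rightarrow> real) \<Rightarrow> bool" where
  "fuzzy_lattice X \<mu> \<longleftrightarrow> fuzzy_poset X \<mu> \<and>
     (\<forall>x\<in>X. \<forall>y\<in>X. x \<noteq> y \<longrightarrow>
        (\<exists>m. is_fuzzy_meet X \<mu> {x, y} m) \<and> (\<exists>j. is_fuzzy_join X \<mu> {x, y} j))"

definition bounded_fuzzy_lattice :: "'a set \<Rightarrow> ('a \<Rightarrow> 'a \<Rightarrow> real) \<Rightarrow> bool" where
  "bounded_fuzzy_lattice X \<mu> \<longleftrightarrow> fuzzy_lattice X \<mu> \<and>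
     (\<exists>b\<in>X. \<exists>t\<in>X. \<forall>x\<in>X. \<mu> b x > 0 \<and> \<mu> x t > 0)"

definition triangular_norm :: "(real \<Rightarrow> real \<Rightarrow> real) \<Rightarrow> bool" where
  "triangular_norm \<tau> \<longleftrightarrow>
     (\<forall>a\<in>{0..1}. \<forall>b\<in>{0..1}. \<tau> a b \<in> {0..1}) \<and>
     (\<forall>a\<in>{0..1}. \<forall>b\<in>{0..1}. \<forall>c\<in>{0..1}. \<tau> (\<tau> a b) c = \<tau> a (\<tau> b c)) \<and>
     (\<forall>a\<in>{0..1}. \<forall>b\<in>{0..1}. \<tau> a b = \<tau> b a) \<and>
     (\<forall>a\<in>{0..1}. \<forall>b\<in>{0..1}. \<forall>c\<in>{0..1}.
        a \<le> b \<longrightarrow> \<tau> a c \<le> \<tau> b c \<and> \<tau> c a \<le> \<tau> c b) \<and>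
     (\<forall>a\<in>{0..1}. \<tau> a 1 = a)"

definition has_zero_divisors :: "(real \<Rightarrow> real \<Rightarrow> real) \<Rightarrow> bool" where
  "has_zero_divisors \<tau> \<longleftrightarrow> (\<exists>a\<in>{0<..<1}. \<exists>b\<in>{0<..<1}. \<tau> a b = 0)"

text \<open>The tuple \<open>(a\<^sub>1, \<dots>, a\<^sub>n)\<close> is the restriction of \<open>a\<close> to \<open>{1..n}\<close>. The extension is
  only meant for \<open>n \<ge> 1\<close>; the value at \<open>0\<close> is the conventional empty product.\<close>

fun tnorm_ext :: "(real \<Rightarrow> real \<Rightarrow> real) \<Rightarrow> nat \<Rightarrow> (nat \<Rightarrow> real) \<Rightarrow> real" where
  "tnorm_ext \<tau> 0 a = 1"
| "tnorm_ext \<tau> (Suc 0) a = a 1"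
| "tnorm_ext \<tau> (Suc (Suc n)) a = \<tau> (tnorm_ext \<tau> (Suc n) a) (a (Suc (Suc n)))"

definition fuzzy_prod_rel ::
    "(real \<Rightarrow> real \<Rightarrow> real) \<Rightarrow> nat \<Rightarrow> (nat \<Rightarrow> 'a \<Rightarrow> 'a \<Rightarrow> real)
      \<Rightarrow> (nat \<Rightarrow> 'a) \<Rightarrow> (nat \<Rightarrow> 'a) \<Rightarrow> real" where
  "fuzzy_prod_rel \<tau> n \<mu> x y = tnorm_ext \<tau> n (\<lambda>i. \<mu> i (x i) (y i))"

end

theory Submission
  imports Defs
begin

text \<open>Without zero divisors, \<open>\<tau>\<close> is positive exactly when both arguments are, so the
  product relation is positive exactly when every component is. Hence transitivity,
  antisymmetry, meets, joins and bounds, all of which only mention positivity, can be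
  checked componentwise.\<close>

text \<open>Monotonicity and the unit law give \<open>\<tau> a b \<le> \<tau> a 1 = a\<close>, and
  commutativity gives the same bound by \<open>b\<close>; so a positive value forces both arguments
  to be positive.\<close>

lemma triangular_norm_pos_iff:
  assumes t: "triangular_norm \<tau>" and z: "\<not> has_zero_divisors \<tau>"
    and a: "a \<in> {0..1}" and b: "b \<in> {0..1}"
  shows "\<tau> a b > 0 \<longleftrightarrow> a > 0 \<and> b > 0"
proof
  have unit: "\<tau> c 1 = c" if "c \<in> {0..1}" for c
    using t that unfolding triangular_norm_def by blast
  have mono: "\<tau> c d \<le> \<tau> c 1" if "c \<in> {0..1}" "d \<in> {0..1}" for c d
  proof -
    have "d \<le> 1" "(1::real) \<in> {0..1}" using that by auto
    then show ?thesis using t that unfolding triangular_norm_def by blast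
  qed
  have comm: "\<tau> c d = \<tau> d c" if "c \<in> {0..1}" "d \<in> {0..1}" for c d
    using t that unfolding triangular_norm_def by blast
  have range: "\<tau> a b \<in> {0..1}"
    using t a b unfolding triangular_norm_def by blast
  show "a > 0 \<and> b > 0" if "\<tau> a b > 0"
    using that mono[OF a b] mono[OF b a] unit[OF a] unit[OF b] comm[OF a b] by linarith
  show "\<tau> a b > 0" if pos: "a > 0 \<and> b > 0"
  \<comment> \<open>\<open>has_zero_divisors\<close> speaks only about the open unit interval, so an
    argument equal to 1 is settled by the unit law instead.\<close>
  proof (cases "a = 1 \<or> b = 1")
    case True
    then show ?thesis using pos unit[OF a] unit[OF b] comm[OF a b] by auto
  next
    case False
    then have "\<tau> a b \<noteq> 0"
      using z pos a b unfolding has_zero_divisors_def by auto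
    then show ?thesis using range by auto
  qed
qed

text \<open>This merges the two nonzero cases of the definition: at \<open>n = 0\<close> the
  conventional value 1 is absorbed, since by commutativity 1 is also a left unit on [0,1]. The
  inductions below can thus start from the empty product.\<close>

lemma tnorm_ext_Suc:
  assumes "triangular_norm \<tau>" and "a (Suc n) \<in> {0..1}"
  shows "tnorm_ext \<tau> (Suc n) a = \<tau> (tnorm_ext \<tau> n a) (a (Suc n))"
proof (cases n)
  case 0
  have "\<tau> 1 (a 1) = \<tau> (a 1) 1" "\<tau> (a 1) 1 = a 1"
  proof -
    have "a 1 \<in> {0..1}" "(1::real) \<in> {0..1}" using assms(2) 0 by auto
    then show "\<tau> 1 (a 1) = \<tau> (a 1) 1" "\<tau> (a 1) 1 = a 1"
      using assms(1) unfolding triangular_norm_def by blast+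
  qed
  then show ?thesis using 0 by simp
qed simp

lemma tnorm_ext_range:
  assumes t: "triangular_norm \<tau>" and "\<And>i. i \<in> {1..n} \<Longrightarrow> a i \<in> {0..1}"
  shows "tnorm_ext \<tau> n a \<in> {0..1}"
  using assms(2)
proof (induction n)
  case (Suc n)
  have a: "a (Suc n) \<in> {0..1}" by (rule Suc.prems) simp
  have "tnorm_ext \<tau> n a \<in> {0..1}" by (intro Suc.IH Suc.prems) simp
  then show ?case
    unfolding tnorm_ext_Suc[of \<tau> a n, OF t a] using t a unfolding triangular_norm_def by blast
qed simp

lemma tnorm_ext_pos_iff:
  assumes t: "triangular_norm \<tau>" and z: "\<not> has_zero_divisors \<tau>"
    and "\<And>i. i \<in> {1..n} \<Longrightarrow> a i \<in> {0..1}"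
  shows "tnorm_ext \<tau> n a > 0 \<longleftrightarrow> (\<forall>i\<in>{1..n}. a i > 0)"
  using assms(3)
proof (induction n)
  case (Suc n)
  have a: "a (Suc n) \<in> {0..1}" by (rule Suc.prems) simp
  \<comment> \<open>The laws of \<open>\<tau>\<close> are assumed on [0,1] only, so the partial
    product must be known to lie there before the binary criterion applies to it.\<close>
  have r: "tnorm_ext \<tau> n a \<in> {0..1}" by (intro tnorm_ext_range[OF t] Suc.prems) simp
  have "tnorm_ext \<tau> n a > 0 \<longleftrightarrow> (\<forall>i\<in>{1..n}. a i > 0)" by (intro Suc.IH Suc.prems) simp
  then show ?case
    unfolding tnorm_ext_Suc[of \<tau> a n, OF t a] triangular_norm_pos_iff[OF t z r a]
    by (auto simp: le_Suc_eq)
qed simp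

text \<open>Reflexivity demands the exact value 1, the one order axiom that the positivity criterion
  cannot deliver.\<close>

lemma tnorm_ext_one:
  assumes t: "triangular_norm \<tau>" and "\<And>i. i \<in> {1..n} \<Longrightarrow> a i = 1"
  shows "tnorm_ext \<tau> n a = 1"
  using assms(2)
proof (induction n)
  case (Suc n)
  have a: "a (Suc n) = 1" by (rule Suc.prems) simp
  have "tnorm_ext \<tau> n a = 1" by (intro Suc.IH Suc.prems) simp
  moreover have "\<tau> 1 1 = 1" using t unfolding triangular_norm_def by simp
  ultimately show ?case using tnorm_ext_Suc[of \<tau> a n] t a by simp
qed simp

text \<open>A fuzzy lattice promises meets of distinct elements only, but distinct tuples may agree
  in some coordinate. There the pair collapses to a singleton, whose meet is its element by
  reflexivity.\<close>

lemma fuzzy_lattice_meet_ex: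
  assumes "fuzzy_lattice X \<mu>" "x \<in> X" "y \<in> X"
  shows "\<exists>m. is_fuzzy_meet X \<mu> {x, y} m"
proof (cases "x = y")
  case True
  then have "is_fuzzy_meet X \<mu> {x, y} x"
    using assms unfolding fuzzy_lattice_def fuzzy_poset_def fuzzy_reflexive_def
      is_fuzzy_meet_def fuzzy_lower_bound_def by auto
  then show ?thesis by blast
qed (use assms in \<open>auto simp: fuzzy_lattice_def\<close>)

lemma fuzzy_lattice_join_ex:
  assumes "fuzzy_lattice X \<mu>" "x \<in> X" "y \<in> X"
  shows "\<exists>j. is_fuzzy_join X \<mu> {x, y} j"
proof (cases "x = y")
  case True
  then have "is_fuzzy_join X \<mu> {x, y} x"
    using assms unfolding fuzzy_lattice_def fuzzy_poset_def fuzzy_reflexive_def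
      is_fuzzy_join_def fuzzy_upper_bound_def by auto
  then show ?thesis by blast
qed (use assms in \<open>auto simp: fuzzy_lattice_def\<close>)

theorem theorem4p6:
  fixes n :: nat
    and \<tau> :: "real \<Rightarrow> real \<Rightarrow> real"
    and X :: "nat \<Rightarrow> 'a set"
    and \<mu> :: "nat \<Rightarrow> 'a \<Rightarrow> 'a \<Rightarrow> real"
  assumes "n \<ge> 1"
    and "triangular_norm \<tau>"
    and "\<not> has_zero_divisors \<tau>"
    and "\<And>i. i \<in> {1..n} \<Longrightarrow> bounded_fuzzy_lattice (X i) (\<mu> i)"
  shows "bounded_fuzzy_lattice (\<Pi>\<^sub>E i\<in>{1..n}. X i) (fuzzy_prod_rel \<tau> n \<mu>)"
proof -
  let ?P = "\<Pi>\<^sub>E i\<in>{1..n}. X i" and ?\<mu> = "fuzzy_prod_rel \<tau> n \<mu>"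
  have lattice: "fuzzy_lattice (X i) (\<mu> i)" if "i \<in> {1..n}" for i
    using assms(4)[OF that] unfolding bounded_fuzzy_lattice_def by blast
  have poset: "fuzzy_relation (X i) (\<mu> i)" "fuzzy_reflexive (X i) (\<mu> i)"
    "fuzzy_transitive (X i) (\<mu> i)" "fuzzy_antisymmetric (X i) (\<mu> i)" if "i \<in> {1..n}" for i
    using lattice[OF that] unfolding fuzzy_lattice_def fuzzy_poset_def by blast+
  have range: "\<mu> i (x i) (y i) \<in> {0..1}" if "x \<in> ?P" "y \<in> ?P" "i \<in> {1..n}" for x y i
    using poset(1)[OF that(3)] PiE_mem[OF that(1,3)] PiE_mem[OF that(2,3)]
    unfolding fuzzy_relation_def by blast
  \<comment> \<open>Membership in the product is essential here: each \<open>\<mu> i\<close> is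
    known to take values in [0,1] only on \<open>X i\<close>.\<close>
  have pos: "?\<mu> x y > 0 \<longleftrightarrow> (\<forall>i\<in>{1..n}. \<mu> i (x i) (y i) > 0)"
    if "x \<in> ?P" "y \<in> ?P" for x y
    unfolding fuzzy_prod_rel_def
    by (rule tnorm_ext_pos_iff[OF assms(2,3)]) (rule range[OF that])
  have rel: "fuzzy_relation ?P ?\<mu>"
    unfolding fuzzy_relation_def fuzzy_prod_rel_def
    by (intro ballI tnorm_ext_range[OF assms(2)] range)
  have refl: "fuzzy_reflexive ?P ?\<mu>"
    unfolding fuzzy_reflexive_def fuzzy_prod_rel_def
    by (intro ballI tnorm_ext_one[OF assms(2)])
      (use poset(2) in \<open>unfold fuzzy_reflexive_def, meson PiE_mem\<close>)
  have trans: "fuzzy_transitive ?P ?\<mu>"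
    unfolding fuzzy_transitive_def
  proof (intro ballI impI)
    fix x y z assume x: "x \<in> ?P" and y: "y \<in> ?P" and z: "z \<in> ?P"
      and "0 < ?\<mu> x y \<and> 0 < ?\<mu> y z"
    then have le: "\<forall>i\<in>{1..n}. \<mu> i (x i) (y i) > 0 \<and> \<mu> i (y i) (z i) > 0"
      using pos by blast
    show "?\<mu> x z > 0"
      unfolding pos[OF x z]
    proof
      fix i assume i: "i \<in> {1..n}"
      then show "\<mu> i (x i) (z i) > 0"
        using le poset(3)[OF i] PiE_mem[OF x i] PiE_mem[OF y i] PiE_mem[OF z i]
        unfolding fuzzy_transitive_def by blast
    qed
  qed
  have antisym: "fuzzy_antisymmetric ?P ?\<mu>"
    unfolding fuzzy_antisymmetric_def
  proof (intro ballI impI)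
    fix x y assume x: "x \<in> ?P" and y: "y \<in> ?P" and "0 < ?\<mu> x y \<and> 0 < ?\<mu> y x"
    then have le: "\<forall>i\<in>{1..n}. \<mu> i (x i) (y i) > 0 \<and> \<mu> i (y i) (x i) > 0"
      using pos by blast
    show "x = y"
    \<comment> \<open>Tuples are extensional functions, all \<open>undefined\<close> outside
      \<open>{1..n}\<close>, so agreement on \<open>{1..n}\<close> is equality.\<close>
    proof (rule PiE_ext[OF x y])
      fix i assume i: "i \<in> {1..n}"
      then show "x i = y i"
        using le poset(4)[OF i] PiE_mem[OF x i] PiE_mem[OF y i]
        unfolding fuzzy_antisymmetric_def by blast
    qed
  qed
  have meet: "\<exists>m. is_fuzzy_meet ?P ?\<mu> {x, y} m" if x: "x \<in> ?P" and y: "y \<in> ?P" for x y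
  proof -
    have "\<forall>i\<in>{1..n}. \<exists>m. is_fuzzy_meet (X i) (\<mu> i) {x i, y i} m"
      using fuzzy_lattice_meet_ex[OF lattice] PiE_mem[OF x] PiE_mem[OF y] by blast
    then obtain m where m: "\<forall>i\<in>{1..n}. is_fuzzy_meet (X i) (\<mu> i) {x i, y i} (m i)"
      by metis
    \<comment> \<open>The choice of coordinatewise meets is arbitrary outside \<open>{1..n}\<close>;
      restricting it yields a genuine element of the product.\<close>
    let ?m = "restrict m {1..n}"
    have mP: "?m \<in> ?P"
      using m unfolding is_fuzzy_meet_def fuzzy_lower_bound_def by auto
    have "fuzzy_lower_bound ?P ?\<mu> {x, y} ?m"
      using m mP pos[OF mP x] pos[OF mP y]
      unfolding is_fuzzy_meet_def fuzzy_lower_bound_def by simp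
    moreover have "?\<mu> z ?m > 0" if z: "fuzzy_lower_bound ?P ?\<mu> {x, y} z" for z
    proof -
      have zP: "z \<in> ?P" using z unfolding fuzzy_lower_bound_def by blast
      \<comment> \<open>By \<open>pos\<close>, a lower bound of the two tuples projects to a lower
        bound in every coordinate, where it lies below \<open>m i\<close>; \<open>pos\<close> then
        reassembles these comparisons.\<close>
      have "\<forall>i\<in>{1..n}. fuzzy_lower_bound (X i) (\<mu> i) {x i, y i} (z i)"
        using z pos[OF zP x] pos[OF zP y] PiE_mem[OF zP]
        unfolding fuzzy_lower_bound_def by blast
      then show ?thesis
        using m unfolding pos[OF zP mP] is_fuzzy_meet_def by simp
    qed
    ultimately show ?thesis unfolding is_fuzzy_meet_def by blast
  qed
  \<comment> \<open>Dual to the meet, with the arguments of the relation exchanged.\<close>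
  have join: "\<exists>j. is_fuzzy_join ?P ?\<mu> {x, y} j" if x: "x \<in> ?P" and y: "y \<in> ?P" for x y
  proof -
    have "\<forall>i\<in>{1..n}. \<exists>j. is_fuzzy_join (X i) (\<mu> i) {x i, y i} j"
      using fuzzy_lattice_join_ex[OF lattice] PiE_mem[OF x] PiE_mem[OF y] by blast
    then obtain j where j: "\<forall>i\<in>{1..n}. is_fuzzy_join (X i) (\<mu> i) {x i, y i} (j i)"
      by metis
    let ?j = "restrict j {1..n}"
    have jP: "?j \<in> ?P"
      using j unfolding is_fuzzy_join_def fuzzy_upper_bound_def by auto
    have "fuzzy_upper_bound ?P ?\<mu> {x, y} ?j"
      using j jP pos[OF x jP] pos[OF y jP]
      unfolding is_fuzzy_join_def fuzzy_upper_bound_def by simp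
    moreover have "?\<mu> ?j z > 0" if z: "fuzzy_upper_bound ?P ?\<mu> {x, y} z" for z
    proof -
      have zP: "z \<in> ?P" using z unfolding fuzzy_upper_bound_def by blast
      have "\<forall>i\<in>{1..n}. fuzzy_upper_bound (X i) (\<mu> i) {x i, y i} (z i)"
        using z pos[OF x zP] pos[OF y zP] PiE_mem[OF zP]
        unfolding fuzzy_upper_bound_def by blast
      then show ?thesis
        using j unfolding pos[OF jP zP] is_fuzzy_join_def by simp
    qed
    ultimately show ?thesis unfolding is_fuzzy_join_def by blast
  qed
  have "\<forall>i\<in>{1..n}. \<exists>b t. b \<in> X i \<and> t \<in> X i \<and> (\<forall>x\<in>X i. \<mu> i b x > 0 \<and> \<mu> i x t > 0)"
    using assms(4) unfolding bounded_fuzzy_lattice_def by blast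
  then obtain b t where bt: "\<forall>i\<in>{1..n}. b i \<in> X i \<and> t i \<in> X i \<and>
      (\<forall>x\<in>X i. \<mu> i (b i) x > 0 \<and> \<mu> i x (t i) > 0)"
    by metis
  \<comment> \<open>The tuples of coordinate bottoms and tops, again made extensional, bound the
    product.\<close>
  let ?b = "restrict b {1..n}" and ?t = "restrict t {1..n}"
  have bP: "?b \<in> ?P" and tP: "?t \<in> ?P" using bt by auto
  have "?\<mu> ?b x > 0 \<and> ?\<mu> x ?t > 0" if x: "x \<in> ?P" for x
    using bt PiE_mem[OF x] unfolding pos[OF bP x] pos[OF x tP] by simp
  with bP tP have "\<exists>b\<in>?P. \<exists>t\<in>?P. \<forall>x\<in>?P. ?\<mu> b x > 0 \<and> ?\<mu> x t > 0" by blast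
  then show ?thesis
    using rel refl trans antisym meet join
    unfolding bounded_fuzzy_lattice_def fuzzy_lattice_def fuzzy_poset_def by blast
qed

end
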